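(* Let $n\ge2$ be an integer and $c\in\mathbb{R}\setminus\{0\}$. (1) Suppose $n$ is odd, or $n$ is even and $c<0$. For every natural $k$ with $1\le k\le n/2$, put $a_k=\cos(2k\pi/n)$, $b_k=\sin(2k\pi/n)$ and, for $x\in\mathbb{C}$, $$y_k^+(x)=\int_0^\infty e^{-(-c)^{n-1}\frac{w^n}{n}}\Bigl[e^{-cwx}-e^{-cwxa_k}\cos\Bigl(cwxb_k-\frac{2k\pi}{n}\Bigr)\Bigr]dw,$$ $$y_k^-(x)=-\int_0^\infty e^{-(-c)^{n-1}\frac{w^n}{n}-cwxa_k}\sin\Bigl(cwxb_k-\frac{2k\pi}{n}\Bigr)dw .$$ Then for all $x\in\mathbb{C}$ $$y_k^+(x)=\sum_{j=0}^\infty\frac{(-\mathrm{sgn}(c)x)^j}{j!}\Bigl[1-\cos\Bigl((j+1)\frac{2k\pi}{n}\Bigr)\Bigr]\Gamma\Bigl(\frac{j+1}{n}\Bigr)(n|c|)^{\frac{j+1}{n}-1},$$ $$y_k^-(x)=\sum_{j=0}^\infty\frac{(-\mathrm{sgn}(c)x)^j}{j!}\sin\Bigl((j+1)\frac{2k\pi}{n}\Bigr)\Gamma\Bigl(\frac{j+1}{n}\Bigr)(n|c|)^{\frac{j+1}{n}-1}.$$ (2) Suppose $n$ is even and $c>0$. Put $a_k=\cos((2k+1)\pi/n)$, $b_k=\sin((2k+1)\pi/n)$ and, for $x\in\mathbb{C}$, $$y_k^+(x)=\int_0^\infty e^{-c^{n-1}\frac{w^n}{n}}\Bigl[e^{i\frac{\pi}{n}}e^{-cwxe^{i\pi/n}}-e^{-cwxa_k}\cos\Bigl(cwxb_k-\frac{2k+1}{n}\pi\Bigr)\Bigr]dw,\quad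 k=1,\dots,\frac n2-1,$$ $$y_k^-(x)=-\int_0^\infty e^{-c^{n-1}\frac{w^n}{n}-cwxa_k}\sin\Bigl(cwxb_k-\frac{2k+1}{n}\pi\Bigr)dw,\quad k=0,\dots,\frac n2-1.$$ Then for all $x\in\mathbb{C}$ $$y_k^+(x)=\sum_{j=0}^\infty\frac{(-x)^j}{j!}\Bigl[e^{i\frac{\pi}{n}(j+1)}-\cos\Bigl((j+1)\frac{(2k+1)\pi}{n}\Bigr)\Bigr]\Gamma\Bigl(\frac{j+1}{n}\Bigr)(nc)^{\frac{j+1}{n}-1},\quad k=1,\dots,\frac n2-1,$$ $$y_k^-(x)=\sum_{j=0}^\infty\frac{(-x)^j}{j!}\sin\Bigl((j+1)\frac{(2k+1)\pi}{n}\Bigr)\Gamma\Bigl(\frac{j+1}{n}\Bigr)(nc)^{\frac{j+1}{n}-1},\quad k=0,\dots,\frac n2-1.$$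
   Context: $\Gamma$ is Euler's Gamma function and $\mathrm{sgn}$ is the sign function. Sine and cosine of complex arguments are the usual entire functions. *)

theory Defs
  imports "HOL-Analysis.Analysis"
begin

(* Names with 1 belong to the case "n odd, or n even and c < 0", where (- c) ^ (n - 1) > 0;
   names with 2 to the case "n even and c > 0". The integrals over (0, oo) are Lebesgue
   integrals, which are 0 by convention if the integrand is not integrable: integrability
   of the integrands has to be asserted separately. *)

definition a1 :: "nat \<Rightarrow> nat \<Rightarrow> real" where
  "a1 n k = cos (2 * real k * pi / real n)"

definition b1 :: "nat \<Rightarrow> nat \<Rightarrow> real" where
  "b1 n k = sin (2 * real k * pi / real n)"

definition y1_plus_integrand :: "nat \<Rightarrow> real \<Rightarrow> nat \<Rightarrow> complex \<Rightarrow> real \<Rightarrow> complex" where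
  "y1_plus_integrand n c k x w =
     of_real (exp (- ((- c) ^ (n - 1) * (w ^ n / real n)))) *
     (exp (- (of_real (c * w) * x))
      - exp (- (of_real (c * w) * x * of_real (a1 n k)))
        * cos (of_real (c * w) * x * of_real (b1 n k) - of_real (2 * real k * pi / real n)))"

definition y1_minus_integrand :: "nat \<Rightarrow> real \<Rightarrow> nat \<Rightarrow> complex \<Rightarrow> real \<Rightarrow> complex" where
  "y1_minus_integrand n c k x w =
     exp (- of_real ((- c) ^ (n - 1) * (w ^ n / real n)) - of_real (c * w) * x * of_real (a1 n k)) *
     sin (of_real (c * w) * x * of_real (b1 n k) - of_real (2 * real k * pi / real n))"

definition y1_plus :: "nat \<Rightarrow> real \<Rightarrow> nat \<Rightarrow> complex \<Rightarrow> complex" where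
  "y1_plus n c k x = (LINT w:{0..}|lborel. y1_plus_integrand n c k x w)"

definition y1_minus :: "nat \<Rightarrow> real \<Rightarrow> nat \<Rightarrow> complex \<Rightarrow> complex" where
  "y1_minus n c k x = - (LINT w:{0..}|lborel. y1_minus_integrand n c k x w)"

definition a2 :: "nat \<Rightarrow> nat \<Rightarrow> real" where
  "a2 n k = cos ((2 * real k + 1) * pi / real n)"

definition b2 :: "nat \<Rightarrow> nat \<Rightarrow> real" where
  "b2 n k = sin ((2 * real k + 1) * pi / real n)"

definition y2_plus_integrand :: "nat \<Rightarrow> real \<Rightarrow> nat \<Rightarrow> complex \<Rightarrow> real \<Rightarrow> complex" where
  "y2_plus_integrand n c k x w =
     of_real (exp (- (c ^ (n - 1) * (w ^ n / real n)))) *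
     (exp (\<i> * of_real (pi / real n))
        * exp (- (of_real (c * w) * x * exp (\<i> * of_real (pi / real n))))
      - exp (- (of_real (c * w) * x * of_real (a2 n k)))
        * cos (of_real (c * w) * x * of_real (b2 n k) - of_real ((2 * real k + 1) / real n * pi)))"

definition y2_minus_integrand :: "nat \<Rightarrow> real \<Rightarrow> nat \<Rightarrow> complex \<Rightarrow> real \<Rightarrow> complex" where
  "y2_minus_integrand n c k x w =
     exp (- of_real (c ^ (n - 1) * (w ^ n / real n)) - of_real (c * w) * x * of_real (a2 n k)) *
     sin (of_real (c * w) * x * of_real (b2 n k) - of_real ((2 * real k + 1) / real n * pi))"

definition y2_plus :: "nat \<Rightarrow> real \<Rightarrow> nat \<Rightarrow> complex \<Rightarrow> complex" where
  "y2_plus n c k x = (LINT w:{0..}|lborel. y2_plus_integrand n c k x w)"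

definition y2_minus :: "nat \<Rightarrow> real \<Rightarrow> nat \<Rightarrow> complex \<Rightarrow> complex" where
  "y2_minus n c k x = - (LINT w:{0..}|lborel. y2_minus_integrand n c k x w)"

end

theory Submission
  imports Defs begin

text \<open>
  Writing \<open>exp (- a w^n + w z)\<close> as a power series in \<open>z\<close> and integrating termwise over \<open>w\<close>
  (dominated by \<open>exp (\<bar>z\<bar> w - a w^n)\<close>, which is integrable since \<open>n \<ge> 2\<close>) reduces everything to
  the moments of \<open>exp (- a w^n)\<close>; these are Gamma values by the substitution \<open>t = a w^n\<close>.
  Each integrand of the theorem is a linear combination of such exponentials with
  \<open>z = - c x e^(i\<theta>)\<close>, and a prefactor \<open>e^(i\<theta>)\<close> turns the \<open>j\<close>-th coefficient
  \<open>e^(ij\<theta>)\<close> into \<open>e^(i(j+1)\<theta>)\<close>.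
\<close>

section \<open>Moments of \<open>exp (- (a * w ^ n))\<close> as Gamma values\<close>

text \<open>The substitution \<open>t = a * w ^ n\<close> in Euler's integral for
  \<open>Gamma s\<close>, with \<open>s = (j + 1) / n\<close>, produces the moment up to the factor
  \<open>n * a powr s\<close>. It is carried out on the open half-line, which the substitution maps
  bijectively onto itself and where the laws of \<open>powr\<close> apply; the endpoint 0 is a null
  set. The case \<open>n = 1\<close> is included because \<open>exp (- w)\<close> later serves as a
  majorant.\<close>

lemma power_exp_integral:
  fixes a :: real and n j :: nat
  assumes n: "n > 0" and a: "a > 0"
  shows power_exp_set_integrable: "set_integrable lborel {0..} (\<lambda>w. w ^ j * exp (- (a * w ^ n)))"
    and power_exp_set_integral: "(LINT w:{0..}|lborel. w ^ j * exp (- (a * w ^ n)))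
      = Gamma ((real j + 1) / real n) / (real n * a powr ((real j + 1) / real n))"
proof -
  define s where "s = (real j + 1) / real n"
  have s: "s > 0" using n by (simp add: s_def)
  let ?G = "\<lambda>t::real. t powr (s - 1) / exp t"
  let ?g = "\<lambda>w::real. a * w ^ n"
  let ?g' = "\<lambda>w::real. a * (real n * w ^ (n - 1))"
  let ?f = "\<lambda>w::real. w ^ j * exp (- (a * w ^ n))"
  let ?C = "real n * a powr s"
  have hi: "(?G has_integral Gamma s) {0<..}"
  proof -
    have "(?G has_integral Gamma s) {0<..} \<longleftrightarrow> (?G has_integral Gamma s) {0..}"
      by (intro has_integral_spike_set_eq; rule negligible_subset[of "{0}"]) auto
    thus ?thesis using Gamma_integral_real[OF s] by simp
  qed
  have Gint: "?G absolutely_integrable_on {0<..}"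
    by (rule nonnegative_absolutely_integrable_1) (use hi in auto)
  have img: "?g ` {0<..} = {0<..}"
  proof (intro equalityI subsetI)
    fix t :: real assume "t \<in> {0<..}"
    hence t: "t > 0" by simp
    have "t = ?g (root n (t / a))" using t a n by simp
    moreover have "root n (t / a) \<in> {0<..}" using t a n by simp
    ultimately show "t \<in> ?g ` {0<..}" by blast
  qed (use a in auto)
  have inj: "inj_on ?g {0<..}"
    using a n by (auto simp: inj_on_def power_eq_iff_eq_base)
  have der: "(?g has_field_derivative ?g' w) (at w within {0<..})" for w
    by (auto intro!: derivative_eq_intros)
  \<comment> \<open>Since \<open>n * s = j + 1\<close>, the Jacobian contributes the exponent
    \<open>n - 1\<close> of \<open>w\<close> and the Gamma integrand contributes
    \<open>n * (s - 1) = j + 1 - n\<close>; together they give \<open>j\<close>. The powers of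
    \<open>a\<close> combine to \<open>a * a powr (s - 1) = a powr s\<close>.\<close>
  have eq: "\<bar>?g' w\<bar> * ?G (?g w) = ?C * ?f w" if "w \<in> {0<..}" for w
  proof -
    have w: "w > 0" using that by simp
    have ns: "real n * s = real j + 1" using n by (simp add: s_def)
    have "(a * w ^ n) powr (s - 1) = a powr (s - 1) * w powr (real n * (s - 1))"
      using a w by (simp add: powr_mult powr_powr powr_realpow[symmetric])
    also have "\<dots> = a powr s / a * (w powr (real j + 1 - real n))"
      using a by (simp add: powr_diff ns right_diff_distrib)
    finally have 1: "(a * w ^ n) powr (s - 1) = a powr s / a * (w powr (real j + 1 - real n))" .
    have 2: "w ^ (n - 1) = w powr (real n - 1)"
      using w n by (metis One_nat_def Suc_leI of_nat_1 of_nat_diff powr_realpow)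
    have 3: "w powr (real n - 1) * w powr (real j + 1 - real n) = w ^ j"
      using w by (simp add: powr_add[symmetric] powr_realpow)
    have "\<bar>?g' w\<bar> = ?g' w" using a w by simp
    moreover have "?g' w * ?G (?g w) = ?C * ((w ^ (n - 1) * w powr (real j + 1 - real n)) * exp (- (a * w ^ n)))"
      unfolding 1 using a by (simp add: exp_minus field_simps)
    ultimately show ?thesis unfolding 2 3 by simp
  qed
  have "(\<lambda>w. \<bar>?g' w\<bar> * ?G (?g w)) absolutely_integrable_on {0<..} \<and>
      integral {0<..} (\<lambda>w. \<bar>?g' w\<bar> * ?G (?g w)) = Gamma s"
    by (subst has_absolute_integral_change_of_variables_1'[OF _ der inj])
       (use Gint integral_unique[OF hi] in \<open>simp_all only: img, simp_all\<close>)
  moreover have "(\<lambda>w. \<bar>?g' w\<bar> * ?G (?g w)) absolutely_integrable_on {0<..}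
      \<longleftrightarrow> (\<lambda>w. ?C * ?f w) absolutely_integrable_on {0<..}"
    by (rule set_integrable_cong) (use eq in auto)
  moreover have "integral {0<..} (\<lambda>w. \<bar>?g' w\<bar> * ?G (?g w)) = integral {0<..} (\<lambda>w. ?C * ?f w)"
    by (rule integral_cong) (rule eq)
  ultimately have "(\<lambda>w. ?C * ?f w) absolutely_integrable_on {0<..}"
      "integral {0<..} (\<lambda>w. ?C * ?f w) = Gamma s"
    by (simp_all only:)
  hence Cint: "(\<lambda>w. ?C * ?f w) absolutely_integrable_on {0<..}" and "?C * integral {0<..} ?f = Gamma s"
    by (simp_all only: Henstock_Kurzweil_Integration.integral_mult_right)
  moreover have C: "?C \<noteq> 0" using a n by simp
  ultimately have fv: "integral {0<..} ?f = Gamma s / ?C"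
    by (metis nonzero_mult_div_cancel_left)
  have fi: "?f absolutely_integrable_on {0<..}"
    using Cint set_integrable_mult_right_iff[OF C, of lebesgue "{0<..}" ?f] by (simp only:)
  have fi': "?f absolutely_integrable_on {0..}"
    by (rule absolutely_integrable_spike_set[OF fi]) (rule negligible_subset[of "{0}"], auto)+
  \<comment> \<open>Absolute integrability refers to \<open>lebesgue\<close>, the completion of
    \<open>lborel\<close>; as the integrand is Borel measurable, integrability carries over to
    \<open>lborel\<close>.\<close>
  show *: "set_integrable lborel {0..} ?f"
    using fi' by (simp add: set_integrable_def integrable_completion)
  have "(LINT w:{0..}|lborel. ?f w) = integral {0..} ?f"
    by (rule set_borel_integral_eq_integral[OF *])
  also have "\<dots> = integral {0<..} ?f"
    by (rule integral_spike_set) (rule negligible_subset[of "{0}"], auto)+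
  finally show "(LINT w:{0..}|lborel. ?f w)
      = Gamma ((real j + 1) / real n) / (real n * a powr ((real j + 1) / real n))"
    using fv by (simp add: s_def)
qed

section \<open>Termwise integration of the exponential series\<close>

text \<open>For \<open>n \<ge> 2\<close> the power beats every linear term: the exponent stays below
  \<open>M - w\<close> for a constant \<open>M\<close>, so \<open>exp M * exp (- w)\<close> is an
  integrable majorant.\<close>

lemma exp_linear_minus_power_set_integrable:
  fixes a r :: real
  assumes n: "n \<ge> 2" and a: "a > 0"
  shows "set_integrable lborel {0..} (\<lambda>w. exp (r * w - a * w ^ n))"
proof (rule set_integrable_bound)
  \<comment> \<open>The quotient is the maximum of
    \<open>(\<bar>r\<bar> + 1) * w - a * w\<^sup>2\<close> and settles \<open>w > 1\<close>, where
    \<open>w\<^sup>2 \<le> w ^ n\<close>. The summand \<open>\<bar>r\<bar> + 1\<close> settles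
    \<open>w \<le> 1\<close>, where that comparison of powers fails but \<open>r * w + w\<close> is
    at most \<open>\<bar>r\<bar> + 1\<close>.\<close>
  define M where "M = (\<bar>r\<bar> + 1)\<^sup>2 / (4 * a) + \<bar>r\<bar> + 1"
  show "set_integrable lborel {0..} (\<lambda>w::real. exp M * (w ^ 0 * exp (- (1 * w ^ 1))))"
    by (intro set_integrable_mult_right impI power_exp_set_integrable) auto
  have "r * w - a * w ^ n \<le> M - w" if w: "w \<ge> 0" for w
  proof -
    have rw: "r * w \<le> \<bar>r\<bar> * w" using w by (intro mult_right_mono) auto
    show ?thesis
    proof (cases "w \<le> 1")
      case True
      have "\<bar>r\<bar> * w \<le> \<bar>r\<bar> * 1" using True by (intro mult_left_mono) auto
      moreover have "0 \<le> a * w ^ n" "0 \<le> (\<bar>r\<bar> + 1)\<^sup>2 / (4 * a)" using a w by auto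
      ultimately show ?thesis using rw True unfolding M_def by linarith
    next
      case False
      have "w ^ 2 \<le> w ^ n" using False n by (intro power_increasing) auto
      hence "a * w\<^sup>2 \<le> a * w ^ n" using a by simp
      \<comment> \<open>Completing the square exhibits the difference to the maximum as
        nonnegative.\<close>
      moreover have "(\<bar>r\<bar> + 1)\<^sup>2 / (4 * a) - (\<bar>r\<bar> + 1) * w + a * w\<^sup>2
          = (2 * a * w - (\<bar>r\<bar> + 1))\<^sup>2 / (4 * a)"
        using a by (simp add: field_simps power2_eq_square)
      moreover have "(2 * a * w - (\<bar>r\<bar> + 1))\<^sup>2 / (4 * a) \<ge> 0" using a by simp
      ultimately have "(\<bar>r\<bar> + 1) * w - a * w ^ n \<le> (\<bar>r\<bar> + 1)\<^sup>2 / (4 * a)" by linarith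
      thus ?thesis using rw unfolding M_def by (simp add: distrib_right)
    qed
  qed
  thus "AE w in lborel. w \<in> {0..} \<longrightarrow> norm (exp (r * w - a * w ^ n))
      \<le> norm (exp M * (w ^ 0 * exp (- (1 * w ^ 1))))"
    by (intro always_eventually) (simp add: exp_add[symmetric])
qed (simp add: set_borel_measurable_def)

text \<open>Sum and integral may be exchanged because the norms of the terms add up pointwise to
  \<open>exp (norm z * w - a * w ^ n)\<close>, which is integrable by the previous lemma. The terms
  \<open>h j\<close> carry the indicator of the half-line, so that results on integrals over the
  whole line apply.\<close>

lemma exp_power_laplace_sums:
  fixes a :: real and z :: complex
  assumes n: "n \<ge> 2" and a: "a > 0"
  shows "set_integrable lborel {0..} (\<lambda>w. of_real (exp (- (a * w ^ n))) * exp (of_real w * z))"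
    and "(\<lambda>j. z ^ j / fact j * of_real (Gamma ((real j + 1) / real n)
             / (real n * a powr ((real j + 1) / real n))))
         sums (LINT w:{0..}|lborel. of_real (exp (- (a * w ^ n))) * exp (of_real w * z))"
proof -
  let ?m = "\<lambda>j w::real. w ^ j * exp (- (a * w ^ n))"
  let ?I = "\<lambda>w::real. indicator {0..} w :: real"
  define h where "h j w = (z ^ j / fact j) * of_real (?I w * ?m j w)" for j w
  have mi: "integrable lborel (\<lambda>w. ?I w * ?m j w)" for j
    using power_exp_set_integrable[of n a j] n a by (simp add: set_integrable_def)
  have h_int: "integrable lborel (h j)" for j
    unfolding h_def by (intro integrable_mult_right integrable_of_real mi)
  have h_val: "integral\<^sup>L lborel (h j) = z ^ j / fact j *
      of_real (Gamma ((real j + 1) / real n) / (real n * a powr ((real j + 1) / real n)))" for j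
  proof -
    have "integral\<^sup>L lborel (h j) = z ^ j / fact j * of_real (\<integral>w. ?I w * ?m j w \<partial>lborel)"
      unfolding h_def by (subst integral_mult_right_zero, subst integral_complex_of_real) (rule refl)
    thus ?thesis
      using power_exp_set_integral[of n a j] n a by (simp add: set_lebesgue_integral_def)
  qed
  have h_norm: "norm (h j w) = ?I w * exp (- (a * w ^ n)) * ((norm z * w) ^ j / fact j)" for j w
    by (simp add: h_def norm_mult norm_divide norm_power power_mult_distrib field_simps
        split: split_indicator)
  have real_sums: "(\<lambda>j. norm (h j w)) sums (?I w * exp (norm z * w - a * w ^ n))" for w
  proof -
    have "(\<lambda>j. (norm z * w) ^ j / fact j) sums exp (norm z * w)"
      using exp_converges[of "norm z * w"] by (simp add: divide_inverse_commute)
    hence "(\<lambda>j. norm (h j w)) sums (?I w * exp (- (a * w ^ n)) * exp (norm z * w))"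
      unfolding h_norm by (rule sums_mult)
    thus ?thesis by (simp add: mult.assoc exp_add[symmetric])
  qed
  have h_sums: "(\<lambda>j. h j w) sums (?I w *\<^sub>R (of_real (exp (- (a * w ^ n))) * exp (of_real w * z)))" for w
  proof -
    have "(\<lambda>j. (of_real w * z) ^ j / fact j) sums exp (of_real w * z)"
      using exp_converges[of "of_real w * z"] by (simp add: scaleR_conv_of_real divide_inverse_commute)
    hence "(\<lambda>j. of_real (?I w * exp (- (a * w ^ n))) * ((of_real w * z) ^ j / fact j))
        sums (of_real (?I w * exp (- (a * w ^ n))) * exp (of_real w * z))"
      by (rule sums_mult)
    moreover have "of_real (?I w * exp (- (a * w ^ n))) * ((of_real w * z) ^ j / fact j) = h j w" for j
      by (simp add: h_def power_mult_distrib field_simps)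
    ultimately show ?thesis by (simp add: scaleR_conv_of_real mult_ac)
  qed
  have dom: "integrable lborel (\<lambda>w. ?I w * exp (norm z * w - a * w ^ n))"
    using exp_linear_minus_power_set_integrable[OF n a, of "norm z"] by (simp add: set_integrable_def)
  \<comment> \<open>The partial sums of the L1 norms are bounded by the integral of the
    majorant.\<close>
  have "summable (\<lambda>j. \<integral>w. norm (h j w) \<partial>lborel)"
  proof (rule summableI_nonneg_bounded)
    fix N
    have "(\<Sum>j<N. \<integral>w. norm (h j w) \<partial>lborel) = (\<integral>w. (\<Sum>j<N. norm (h j w)) \<partial>lborel)"
      by (intro Bochner_Integration.integral_sum[symmetric] integrable_norm h_int)
    also have "\<dots> \<le> (\<integral>w. ?I w * exp (norm z * w - a * w ^ n) \<partial>lborel)"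
    proof (intro integral_mono dom Bochner_Integration.integrable_sum integrable_norm h_int)
      show "(\<Sum>j<N. norm (h j w)) \<le> ?I w * exp (norm z * w - a * w ^ n)" for w
        using real_sums[of w] by (metis sum_le_suminf finite_lessThan norm_ge_zero sums_iff)
    qed
    finally show "(\<Sum>j<N. \<integral>w. norm (h j w) \<partial>lborel)
      \<le> (\<integral>w. ?I w * exp (norm z * w - a * w ^ n) \<partial>lborel)" .
  qed simp
  moreover have "AE w in lborel. summable (\<lambda>j. norm (h j w))"
    using real_sums by (intro always_eventually allI) (rule sums_summable)
  ultimately have "integrable lborel (\<lambda>w. \<Sum>j. h j w)"
      "(\<lambda>j. integral\<^sup>L lborel (h j)) sums (\<integral>w. (\<Sum>j. h j w) \<partial>lborel)"
    using integrable_suminf[OF h_int] sums_integral[OF h_int] by auto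
  thus "set_integrable lborel {0..} (\<lambda>w. of_real (exp (- (a * w ^ n))) * exp (of_real w * z))"
    and "(\<lambda>j. z ^ j / fact j * of_real (Gamma ((real j + 1) / real n)
             / (real n * a powr ((real j + 1) / real n))))
         sums (LINT w:{0..}|lborel. of_real (exp (- (a * w ^ n))) * exp (of_real w * z))"
    using h_sums[THEN sums_unique, symmetric]
    by (simp_all only: set_integrable_def set_lebesgue_integral_def h_val)
qed

section \<open>The exponential kernel with the constants of the theorem\<close>

text \<open>The absolute value lets one kernel serve both cases:
  \<open>\<bar>c\<bar> ^ (n - 1)\<close> is \<open>(- c) ^ (n - 1)\<close> in the first and
  \<open>c ^ (n - 1)\<close> in the second. The parameter \<open>u\<close> will be \<open>x\<close>
  times a complex number of modulus 1.\<close>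

definition kernel :: "nat \<Rightarrow> real \<Rightarrow> complex \<Rightarrow> real \<Rightarrow> complex" where
  "kernel n c u w = of_real (exp (- (\<bar>c\<bar> ^ (n - 1) * (w ^ n / real n)))) * exp (- (of_real (c * w) * u))"

text \<open>This is \<open>\<bar>c\<bar> ^ j\<close> times the \<open>j\<close>-th moment of the
  Gaussian-like factor of \<open>kernel\<close>, the part of the coefficient that all four series
  share.\<close>

definition series_weight :: "nat \<Rightarrow> real \<Rightarrow> nat \<Rightarrow> real" where
  "series_weight n c j = Gamma ((real j + 1) / real n) * (real n * \<bar>c\<bar>) powr ((real j + 1) / real n - 1)"

context
  fixes n :: nat and c :: real
  assumes n: "n \<ge> 2" and c: "c \<noteq> 0"
begin

text \<open>The transform above is taken at \<open>a = \<bar>c\<bar> ^ (n - 1) / n\<close> and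
  \<open>z = - c * u\<close>. Splitting \<open>c\<close> into sign and modulus leaves the sign in
  the power of \<open>u\<close>, while \<open>\<bar>c\<bar> ^ j\<close> is absorbed into the
  weight.\<close>

lemma kernel_set_integrable: "set_integrable lborel {0..} (kernel n c u)"
  and kernel_sums: "(\<lambda>j. (- of_real (sgn c) * u) ^ j / fact j * of_real (series_weight n c j))
    sums (LINT w:{0..}|lborel. kernel n c u w)"
proof -
  define a where "a = \<bar>c\<bar> ^ (n - 1) / real n"
  have a: "a > 0" using n c by (simp add: a_def)
  have k: "kernel n c u = (\<lambda>w. of_real (exp (- (a * w ^ n))) * exp (of_real w * (- of_real c * u)))"
    by (simp add: kernel_def a_def fun_eq_iff mult_ac)
  \<comment> \<open>From \<open>n * s = j + 1\<close> the exponent of \<open>\<bar>c\<bar>\<close>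
    is \<open>j - (n - 1) * s = s - 1\<close>, and that of \<open>n\<close> is \<open>s - 1\<close>
    as well, so the two bases merge.\<close>
  have weight: "\<bar>c\<bar> ^ j / (real n * a powr s) = (real n * \<bar>c\<bar>) powr (s - 1)"
    if s: "s = (real j + 1) / real n" for j s
  proof -
    have "real n * s = real j + 1" using n s by simp
    moreover have "a powr s = \<bar>c\<bar> powr ((real n - 1) * s) / real n powr s"
      using n c powr_realpow[of "\<bar>c\<bar>" "n - 1"]
      by (simp add: a_def powr_divide powr_powr[symmetric] of_nat_diff)
    ultimately have "a powr s = \<bar>c\<bar> powr (real j + 1 - s) / real n powr s"
      by (simp add: left_diff_distrib)
    moreover have "\<bar>c\<bar> ^ j = \<bar>c\<bar> powr real j" using c by (simp add: powr_realpow)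
    ultimately have "\<bar>c\<bar> ^ j / (real n * a powr s)
        = \<bar>c\<bar> powr (real j - (real j + 1 - s)) * real n powr (s - 1)"
      using n c by (simp only: powr_diff) (simp add: field_simps)
    thus ?thesis by (simp add: powr_mult)
  qed
  have "(- of_real c * u) ^ j / fact j * of_real (Gamma ((real j + 1) / real n)
             / (real n * a powr ((real j + 1) / real n)))
      = (- of_real (sgn c) * u) ^ j / fact j * of_real (series_weight n c j)" for j
  proof -
    have "(- of_real c * u) ^ j = (- of_real (sgn c) * u) ^ j * of_real (\<bar>c\<bar> ^ j)"
    proof -
      have "complex_of_real c = of_real (sgn c) * of_real \<bar>c\<bar>"
        by (simp only: of_real_mult[symmetric] mult_sgn_abs)
      hence "- of_real c * u = (- of_real (sgn c) * u) * of_real \<bar>c\<bar>" by simp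
      thus ?thesis by (simp only: power_mult_distrib of_real_power)
    qed
    moreover have "series_weight n c j = \<bar>c\<bar> ^ j * (Gamma ((real j + 1) / real n)
             / (real n * a powr ((real j + 1) / real n)))"
      unfolding series_weight_def weight[OF refl, symmetric] by simp
    ultimately show ?thesis by simp
  qed
  with exp_power_laplace_sums[OF n a, of "- of_real c * u"]
  show "set_integrable lborel {0..} (kernel n c u)"
    and "(\<lambda>j. (- of_real (sgn c) * u) ^ j / fact j * of_real (series_weight n c j))
      sums (LINT w:{0..}|lborel. kernel n c u w)"
    unfolding k by simp_all
qed

text \<open>Linearity, for two terms because a sine or cosine splits into two exponentials, with
  angles \<theta> and -\<theta>.\<close>

lemma kernel_combination:
  assumes "\<And>w. f w = p * kernel n c u w + q * kernel n c v w"
  shows "set_integrable lborel {0..} f"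
    and "(\<lambda>j. (p * (- of_real (sgn c) * u) ^ j + q * (- of_real (sgn c) * v) ^ j)
          / fact j * of_real (series_weight n c j)) sums (LINT w:{0..}|lborel. f w)"
proof -
  have f: "f = (\<lambda>w. p * kernel n c u w + q * kernel n c v w)" using assms by auto
  show "set_integrable lborel {0..} f"
    unfolding f by (intro set_integral_add set_integrable_mult_right impI kernel_set_integrable)
  have "(LINT w:{0..}|lborel. f w)
      = p * (LINT w:{0..}|lborel. kernel n c u w) + q * (LINT w:{0..}|lborel. kernel n c v w)"
    unfolding f by (subst set_integral_add) (simp_all add: kernel_set_integrable)
  moreover have "(\<lambda>j. p * ((- of_real (sgn c) * u) ^ j / fact j * of_real (series_weight n c j))
      + q * ((- of_real (sgn c) * v) ^ j / fact j * of_real (series_weight n c j)))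
      sums (p * (LINT w:{0..}|lborel. kernel n c u w) + q * (LINT w:{0..}|lborel. kernel n c v w))"
    by (intro sums_add sums_mult kernel_sums)
  ultimately show "(\<lambda>j. (p * (- of_real (sgn c) * u) ^ j + q * (- of_real (sgn c) * v) ^ j)
          / fact j * of_real (series_weight n c j)) sums (LINT w:{0..}|lborel. f w)"
    by (simp only: add_divide_distrib distrib_right times_divide_eq_left times_divide_eq_right mult.assoc)
qed

end

section \<open>Sine and cosine factors as exponentials in rotated directions\<close>

text \<open>The prefactor \<open>cis \<theta>\<close> becomes the phase shift by \<theta> that
  occurs inside the sines and cosines of the theorem.\<close>

lemma cis_mult_exp_minus_cis:
  "cis \<theta> * exp (- (t * cis \<theta>)) = exp (- (t * of_real (cos \<theta>))) * exp (- (\<i> * (t * of_real (sin \<theta>) - of_real \<theta>)))"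
proof -
  have "t * cis \<theta> = t * of_real (cos \<theta>) + \<i> * (t * of_real (sin \<theta>))"
    by (simp add: cis_conv_exp exp_Euler cos_of_real sin_of_real algebra_simps)
  thus ?thesis
    unfolding cis_conv_exp by (simp only: exp_add[symmetric]) (simp add: algebra_simps)
qed

text \<open>As \<open>t\<close> is complex, the left side is not a real part; Euler's formula for
  complex arguments is used, with -\<theta> in place of conjugation.\<close>

lemma exp_mult_cos_eq_cis:
  "exp (- (t * of_real (cos \<theta>))) * cos (t * of_real (sin \<theta>) - of_real \<theta>)
    = (cis \<theta> * exp (- (t * cis \<theta>)) + cis (- \<theta>) * exp (- (t * cis (- \<theta>)))) / 2"
  unfolding cis_mult_exp_minus_cis by (simp add: cos_exp_eq algebra_simps)

text \<open>The term with \<open>cis \<theta>\<close> carries the factor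
  \<open>exp (- \<i> * \<phi>)\<close>, where \<phi> is the argument of the sine; hence it is the
  one subtracted.\<close>

lemma exp_mult_sin_eq_cis:
  "exp (- (t * of_real (cos \<theta>))) * sin (t * of_real (sin \<theta>) - of_real \<theta>)
    = (cis (- \<theta>) * exp (- (t * cis (- \<theta>))) - cis \<theta> * exp (- (t * cis \<theta>))) / (2 * \<i>)"
  unfolding cis_mult_exp_minus_cis by (simp add: sin_exp_eq algebra_simps)

lemma exp_minus_of_real_diff: "exp (- of_real r - z) = of_real (exp (- r)) * exp (- z :: complex)"
  by (simp add: exp_of_real[symmetric] exp_add[symmetric] del: exp_of_real)

lemma power_mult_cis: "cis \<theta> * (z * cis \<theta>) ^ j = z ^ j * cis ((real j + 1) * \<theta>)"
proof -
  have "cis \<theta> * (z * cis \<theta>) ^ j = z ^ j * (cis (real j * \<theta>) * cis \<theta>)"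
    by (simp add: power_mult_distrib Complex.DeMoivre)
  thus ?thesis by (simp add: cis_mult algebra_simps)
qed

section \<open>Series for the damped cosine and sine integrals at an arbitrary angle\<close>

definition damped_cos :: "nat \<Rightarrow> real \<Rightarrow> real \<Rightarrow> complex \<Rightarrow> real \<Rightarrow> complex" where
  "damped_cos n c \<theta> x w = of_real (exp (- (\<bar>c\<bar> ^ (n - 1) * (w ^ n / real n)))) *
     (exp (- (of_real (c * w) * x * of_real (cos \<theta>)))
       * cos (of_real (c * w) * x * of_real (sin \<theta>) - of_real \<theta>))"

definition damped_sin :: "nat \<Rightarrow> real \<Rightarrow> real \<Rightarrow> complex \<Rightarrow> real \<Rightarrow> complex" where
  "damped_sin n c \<theta> x w = of_real (exp (- (\<bar>c\<bar> ^ (n - 1) * (w ^ n / real n)))) *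
     (exp (- (of_real (c * w) * x * of_real (cos \<theta>)))
       * sin (of_real (c * w) * x * of_real (sin \<theta>) - of_real \<theta>))"

context
  fixes n :: nat and c \<theta> :: real
  assumes n: "n \<ge> 2" and c: "c \<noteq> 0"
begin

text \<open>The integrand is half the sum of two rotated kernels with prefactors
  \<open>cis \<theta>\<close> and \<open>cis (- \<theta>)\<close>; in the \<open>j\<close>-th
  coefficient these average to the cosine of \<open>(j + 1) * \<theta>\<close>.\<close>

lemma damped_cos_set_integrable: "set_integrable lborel {0..} (damped_cos n c \<theta> x)"
  and damped_cos_sums: "(\<lambda>j. (- of_real (sgn c) * x) ^ j / fact j
      * of_real (cos ((real j + 1) * \<theta>) * series_weight n c j))
    sums (LINT w:{0..}|lborel. damped_cos n c \<theta> x w)"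
proof -
  have d: "damped_cos n c \<theta> x w = cis \<theta> / 2 * kernel n c (x * cis \<theta>) w
      + cis (- \<theta>) / 2 * kernel n c (x * cis (- \<theta>)) w" for w
    unfolding damped_cos_def kernel_def exp_mult_cos_eq_cis
    by (simp only: add_divide_distrib distrib_left mult.assoc times_divide_eq_left times_divide_eq_right mult.left_commute)
  show "set_integrable lborel {0..} (damped_cos n c \<theta> x)"
    by (rule kernel_combination(1)[OF n c d])
  let ?z = "- of_real (sgn c) * x :: complex"
  have "cis \<theta> / 2 * (- of_real (sgn c) * (x * cis \<theta>)) ^ j
      + cis (- \<theta>) / 2 * (- of_real (sgn c) * (x * cis (- \<theta>))) ^ j
      = ?z ^ j * of_real (cos ((real j + 1) * \<theta>))" for j
  proof -
    have "cis \<theta> / 2 * (- of_real (sgn c) * (x * cis \<theta>)) ^ j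
      + cis (- \<theta>) / 2 * (- of_real (sgn c) * (x * cis (- \<theta>))) ^ j
      = (cis \<theta> * (?z * cis \<theta>) ^ j + cis (- \<theta>) * (?z * cis (- \<theta>)) ^ j) / 2"
      by (simp add: mult.assoc add_divide_distrib)
    also have "\<dots> = ?z ^ j * of_real (cos ((real j + 1) * \<theta>))"
      unfolding power_mult_cis by (simp add: complex_eq_iff cis.ctr)
    finally show ?thesis .
  qed
  with kernel_combination(2)[OF n c d]
  show "(\<lambda>j. (- of_real (sgn c) * x) ^ j / fact j
      * of_real (cos ((real j + 1) * \<theta>) * series_weight n c j))
    sums (LINT w:{0..}|lborel. damped_cos n c \<theta> x w)"
    by (simp add: mult_ac)
qed

text \<open>Both plus integrands have this shape: \<open>p = 1\<close> and \<open>u = x\<close> in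
  the first case, \<open>p = cis (pi / n)\<close> and \<open>u = x * cis (pi / n)\<close> in the
  second.\<close>

lemma kernel_minus_damped_cos:
  assumes f: "f = (\<lambda>w. p * kernel n c u w - damped_cos n c \<theta> x w)"
  shows "set_integrable lborel {0..} f"
    and "(\<lambda>j. (p * (- of_real (sgn c) * u) ^ j
            - (- of_real (sgn c) * x) ^ j * of_real (cos ((real j + 1) * \<theta>)))
          / fact j * of_real (series_weight n c j)) sums (LINT w:{0..}|lborel. f w)"
proof -
  have k: "set_integrable lborel {0..} (\<lambda>w. p * kernel n c u w)"
    by (intro set_integrable_mult_right impI kernel_set_integrable[OF n c])
  show "set_integrable lborel {0..} f"
    unfolding f by (intro set_integral_diff k damped_cos_set_integrable)
  have "(LINT w:{0..}|lborel. f w)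
      = p * (LINT w:{0..}|lborel. kernel n c u w) - (LINT w:{0..}|lborel. damped_cos n c \<theta> x w)"
    unfolding f by (subst set_integral_diff(2)[OF k damped_cos_set_integrable]) simp
  moreover have "(\<lambda>j. p * ((- of_real (sgn c) * u) ^ j / fact j * of_real (series_weight n c j))
      - (- of_real (sgn c) * x) ^ j / fact j
        * of_real (cos ((real j + 1) * \<theta>) * series_weight n c j))
      sums (p * (LINT w:{0..}|lborel. kernel n c u w) - (LINT w:{0..}|lborel. damped_cos n c \<theta> x w))"
    by (intro sums_diff sums_mult kernel_sums[OF n c] damped_cos_sums)
  ultimately show "(\<lambda>j. (p * (- of_real (sgn c) * u) ^ j
            - (- of_real (sgn c) * x) ^ j * of_real (cos ((real j + 1) * \<theta>)))
          / fact j * of_real (series_weight n c j)) sums (LINT w:{0..}|lborel. f w)"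
    by (simp add: diff_divide_distrib left_diff_distrib right_diff_distrib mult_ac)
qed

lemma damped_sin_set_integrable: "set_integrable lborel {0..} (damped_sin n c \<theta> x)"
  and damped_sin_sums: "(\<lambda>j. (- of_real (sgn c) * x) ^ j / fact j
      * of_real (sin ((real j + 1) * \<theta>) * series_weight n c j))
    sums (- (LINT w:{0..}|lborel. damped_sin n c \<theta> x w))"
proof -
  \<comment> \<open>The negated integrand is decomposed: the minus sign in front of the integrals
    defining the minus functions then yields coefficients \<open>+ sin\<close>.\<close>
  have d: "- damped_sin n c \<theta> x w = cis \<theta> / (2 * \<i>) * kernel n c (x * cis \<theta>) w
      + (- cis (- \<theta>) / (2 * \<i>)) * kernel n c (x * cis (- \<theta>)) w" for w
    unfolding damped_sin_def kernel_def exp_mult_sin_eq_cis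
    by (simp add: diff_divide_distrib right_diff_distrib mult_ac)
  have "set_integrable lborel {0..} (\<lambda>w. - damped_sin n c \<theta> x w)"
    by (rule kernel_combination(1)[OF n c d])
  thus "set_integrable lborel {0..} (damped_sin n c \<theta> x)"
    by (simp add: set_integrable_def)
  let ?z = "- of_real (sgn c) * x :: complex"
  have "cis \<theta> / (2 * \<i>) * (- of_real (sgn c) * (x * cis \<theta>)) ^ j
      + (- cis (- \<theta>) / (2 * \<i>)) * (- of_real (sgn c) * (x * cis (- \<theta>))) ^ j
      = ?z ^ j * of_real (sin ((real j + 1) * \<theta>))" for j
  proof -
    have "cis \<theta> / (2 * \<i>) * (- of_real (sgn c) * (x * cis \<theta>)) ^ j
      + (- cis (- \<theta>) / (2 * \<i>)) * (- of_real (sgn c) * (x * cis (- \<theta>))) ^ j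
      = (cis \<theta> * (?z * cis \<theta>) ^ j - cis (- \<theta>) * (?z * cis (- \<theta>)) ^ j) / (2 * \<i>)"
      by (simp only: mult.assoc diff_divide_distrib times_divide_eq_left mult_minus_left
          minus_divide_left[symmetric] add_uminus_conv_diff)
    also have "\<dots> = ?z ^ j * ((cis ((real j + 1) * \<theta>) - cis (- ((real j + 1) * \<theta>))) / (2 * \<i>))"
      unfolding power_mult_cis
      by (simp only: right_diff_distrib[symmetric] times_divide_eq_right mult_minus_right)
    also have "cis ((real j + 1) * \<theta>) - cis (- ((real j + 1) * \<theta>))
        = of_real (sin ((real j + 1) * \<theta>)) * (2 * \<i>)"
      by (simp add: complex_eq_iff)
    also have "\<dots> / (2 * \<i>) = of_real (sin ((real j + 1) * \<theta>))"
      by (rule nonzero_mult_div_cancel_right) simp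
    finally show ?thesis .
  qed
  with kernel_combination(2)[OF n c d]
  show "(\<lambda>j. (- of_real (sgn c) * x) ^ j / fact j
      * of_real (sin ((real j + 1) * \<theta>) * series_weight n c j))
    sums (- (LINT w:{0..}|lborel. damped_sin n c \<theta> x w))"
    by (simp add: mult_ac set_lebesgue_integral_def)
qed

end

section \<open>Identification of the four integrands\<close>

theorem corollary2p1:
  fixes n :: nat and c :: real
  assumes "n \<ge> 2" and "c \<noteq> 0"
  shows "(odd n \<or> (even n \<and> c < 0) \<longrightarrow>
      (\<forall>k::nat. 1 \<le> k \<and> real k \<le> real n / 2 \<longrightarrow> (\<forall>x::complex.
          set_integrable lborel {0..} (y1_plus_integrand n c k x) \<and>
          (\<lambda>j. (- of_real (sgn c) * x) ^ j / fact j *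
               of_real ((1 - cos ((real j + 1) * (2 * real k * pi / real n)))
                 * Gamma ((real j + 1) / real n)
                 * (real n * \<bar>c\<bar>) powr ((real j + 1) / real n - 1)))
            sums y1_plus n c k x \<and>
          set_integrable lborel {0..} (y1_minus_integrand n c k x) \<and>
          (\<lambda>j. (- of_real (sgn c) * x) ^ j / fact j *
               of_real (sin ((real j + 1) * (2 * real k * pi / real n))
                 * Gamma ((real j + 1) / real n)
                 * (real n * \<bar>c\<bar>) powr ((real j + 1) / real n - 1)))
            sums y1_minus n c k x)))
    \<and> (even n \<and> c > 0 \<longrightarrow>
      (\<forall>k\<in>{1..n div 2 - 1}. \<forall>x::complex.
          set_integrable lborel {0..} (y2_plus_integrand n c k x) \<and>
          (\<lambda>j. (- x) ^ j / fact j *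
               (exp (\<i> * of_real (pi / real n * (real j + 1)))
                 - of_real (cos ((real j + 1) * ((2 * real k + 1) * pi / real n)))) *
               of_real (Gamma ((real j + 1) / real n)
                 * (real n * c) powr ((real j + 1) / real n - 1)))
            sums y2_plus n c k x) \<and>
      (\<forall>k\<in>{0..n div 2 - 1}. \<forall>x::complex.
          set_integrable lborel {0..} (y2_minus_integrand n c k x) \<and>
          (\<lambda>j. (- x) ^ j / fact j *
               of_real (sin ((real j + 1) * ((2 * real k + 1) * pi / real n))
                 * Gamma ((real j + 1) / real n)
                 * (real n * c) powr ((real j + 1) / real n - 1)))
            sums y2_minus n c k x))"
proof (intro conjI impI)
  assume A: "odd n \<or> (even n \<and> c < 0)"
  \<comment> \<open>Either \<open>c < 0\<close>, so that \<open>- c\<close> is the modulus, or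
    \<open>n\<close> is odd and the even exponent \<open>n - 1\<close> removes the sign.\<close>
  have pow: "(- c) ^ (n - 1) = \<bar>c\<bar> ^ (n - 1)"
  proof (cases "c < 0")
    case False
    with A have "even (n - 1)" using assms(1) by auto
    thus ?thesis by (metis abs_minus_cancel power_even_abs)
  qed simp
  show "\<forall>k::nat. 1 \<le> k \<and> real k \<le> real n / 2 \<longrightarrow> (\<forall>x::complex.
          set_integrable lborel {0..} (y1_plus_integrand n c k x) \<and>
          (\<lambda>j. (- of_real (sgn c) * x) ^ j / fact j *
               of_real ((1 - cos ((real j + 1) * (2 * real k * pi / real n)))
                 * Gamma ((real j + 1) / real n)
                 * (real n * \<bar>c\<bar>) powr ((real j + 1) / real n - 1)))
            sums y1_plus n c k x \<and>
          set_integrable lborel {0..} (y1_minus_integrand n c k x) \<and>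
          (\<lambda>j. (- of_real (sgn c) * x) ^ j / fact j *
               of_real (sin ((real j + 1) * (2 * real k * pi / real n))
                 * Gamma ((real j + 1) / real n)
                 * (real n * \<bar>c\<bar>) powr ((real j + 1) / real n - 1)))
            sums y1_minus n c k x)"
  proof (intro allI impI, goal_cases)
    case (1 k x)
    define \<theta> where "\<theta> = 2 * real k * pi / real n"
    have "y1_plus_integrand n c k x = (\<lambda>w. 1 * kernel n c x w - damped_cos n c \<theta> x w)"
      by (simp only: fun_eq_iff y1_plus_integrand_def kernel_def damped_cos_def pow a1_def b1_def
          \<theta>_def right_diff_distrib mult_1_left simp_thms)
    note plus = kernel_minus_damped_cos[OF assms this, folded y1_plus_def]
    have minus: "y1_minus_integrand n c k x = damped_sin n c \<theta> x"
      by (simp only: fun_eq_iff y1_minus_integrand_def damped_sin_def exp_minus_of_real_diff pow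
          a1_def b1_def \<theta>_def mult.assoc simp_thms)
    \<comment> \<open>With \<open>p = 1\<close> and \<open>u = x\<close> both numerators contain the
      same power \<open>y\<close>, which factors out and leaves the real coefficient
      \<open>1 - C\<close>.\<close>
    have alg: "(1 * y - y * of_real C) / F * of_real (G * P) = y / F * of_real ((1 - C) * G * P)"
      for y F :: complex and C G P :: real
      by (simp add: left_diff_distrib right_diff_distrib diff_divide_distrib mult_ac)
    show ?case
      unfolding y1_minus_def minus
      using plus[unfolded series_weight_def alg \<theta>_def] damped_sin_set_integrable[OF assms]
        damped_sin_sums[OF assms, of x \<theta>]
      by (simp only: series_weight_def \<theta>_def mult.assoc simp_thms)
  qed
next
  assume A: "even n \<and> c > 0"
  hence abs: "\<bar>c\<bar> = c" and sgn: "- complex_of_real (sgn c) * y = - y" for y by simp_all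
  show "\<forall>k\<in>{1..n div 2 - 1}. \<forall>x::complex.
          set_integrable lborel {0..} (y2_plus_integrand n c k x) \<and>
          (\<lambda>j. (- x) ^ j / fact j *
               (exp (\<i> * of_real (pi / real n * (real j + 1)))
                 - of_real (cos ((real j + 1) * ((2 * real k + 1) * pi / real n)))) *
               of_real (Gamma ((real j + 1) / real n)
                 * (real n * c) powr ((real j + 1) / real n - 1)))
            sums y2_plus n c k x"
  proof (intro allI ballI, goal_cases)
    case (1 k x)
    define \<theta> where "\<theta> = (2 * real k + 1) * pi / real n"
    have "y2_plus_integrand n c k x
        = (\<lambda>w. cis (pi / real n) * kernel n c (x * cis (pi / real n)) w - damped_cos n c \<theta> x w)"
      unfolding fun_eq_iff y2_plus_integrand_def kernel_def damped_cos_def a2_def b2_def abs cis_conv_exp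
        \<theta>_def times_divide_eq_left by (simp only: right_diff_distrib mult.assoc mult.left_commute simp_thms)
    note plus = kernel_minus_damped_cos[OF assms this, folded y2_plus_def, unfolded sgn]
    \<comment> \<open>Rotating \<open>x\<close> and the prefactor together turn the angle by
      \<open>j + 1\<close> steps of \<open>pi / n\<close>; the remaining \<open>(- x) ^ j\<close> is
      common to both parts of the coefficient.\<close>
    have eq: "cis (pi / real n) * (- (x * cis (pi / real n))) ^ j
        = (- x) ^ j * exp (\<i> * of_real (pi / real n * (real j + 1)))" for j
      using power_mult_cis[of "pi / real n" "- x" j]
      by (simp only: cis_conv_exp mult_minus_left mult.commute[of "pi / real n"])
    have alg: "(y * p - y * q) / F * w = y / F * (p - q) * w" for y p q F w :: complex
      by (simp add: right_diff_distrib diff_divide_distrib mult_ac)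
    show ?case
      using plus[unfolded eq alg series_weight_def \<theta>_def abs] by blast
  qed
next
  assume A: "even n \<and> c > 0"
  hence abs: "\<bar>c\<bar> = c" and sgn: "- complex_of_real (sgn c) * y = - y" for y by simp_all
  show "\<forall>k\<in>{0..n div 2 - 1}. \<forall>x::complex.
          set_integrable lborel {0..} (y2_minus_integrand n c k x) \<and>
          (\<lambda>j. (- x) ^ j / fact j *
               of_real (sin ((real j + 1) * ((2 * real k + 1) * pi / real n))
                 * Gamma ((real j + 1) / real n)
                 * (real n * c) powr ((real j + 1) / real n - 1)))
            sums y2_minus n c k x"
  proof (intro allI ballI, goal_cases)
    case (1 k x)
    define \<theta> where "\<theta> = (2 * real k + 1) * pi / real n"
    have minus: "y2_minus_integrand n c k x = damped_sin n c \<theta> x"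
      by (simp only: fun_eq_iff y2_minus_integrand_def damped_sin_def exp_minus_of_real_diff abs
          a2_def b2_def \<theta>_def mult.assoc times_divide_eq_left simp_thms)
    show ?case
      unfolding y2_minus_def minus
      using damped_sin_set_integrable[OF assms]
        damped_sin_sums[OF assms, of x \<theta>, unfolded sgn]
      by (simp only: series_weight_def \<theta>_def mult.assoc abs simp_thms)
  qed
qed

end
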